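(* Let $X\subset\mathbb R^D$ be a compact set, let $G_1=\{\mathrm{id}_X,f_1,\dots,f_m\}$ where the maps $f_j:X\to X$, $1\le j\le m$, are conformal and expanding on $X$, and let $\mu$ be a Borel probability measure on $X$. Let $Y\subset X$ and $\alpha>0$. If $$h^+_\mu(x,G_1)\le\alpha\quad\text{for all }x\in Y,$$ then $h^+(Y,G_1)\le\alpha$.
   Context: The maps $f_j$ are conformal and expanding on the compact set $X\subset\mathbb R^D$ if $f_j$ is $\mathcal C^1$ and $Df_j(x)=a_j(x)A_j(x)$ for all $x\in X$, $1\le j\le m$, where $A_j(x)$ is a linear isometry of $\mathbb R^D$, $a_j(x)\in\mathbb R$, and there is $\gamma>1$ with $|a_j(x)|>\gamma>1$ for all $x\in X$, $1\le j\le m$. Write $f_{j_1\dots j_n}:=f_{j_1}\circ\dots\circ f_{j_n}$. For a word $C=(i_1,\dots,i_n)$ over $\{1,\dots,m\}$ of length $|C|=n$, $$B_n(y,C,\varepsilon)=\{z\in X: d(y,z)<\varepsilon,\ d(f_{i_k\dots i_1}(y),f_{i_k\dots i_1}(z))<\varepsilon,\ 1\le k\le n\},$$ and the exhaustive ball is $B_n^+(x,G_1,\varepsilon)=\bigcup_{|C|=n}B_n(x,C,\varepsilon)$. Local exhaustive entropy of $\mu$ at $x$ (with $\log 0^{-1}=+\infty$): $$h^+_\mu(x,G_1)=\lim_{\varepsilon\to0}\liminf_{n\to\infty}\frac{\log\mu(B_n^+(x,G_1,\varepsilon))^{-1}}{n}.$$ Exhaustive topological entropy $h^+(Y,G_1)$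 (the exhaustive pressure of the zero multi-potential): let $M^+(Y,\lambda,N,\varepsilon)=\inf\sum_{x\in\mathcal F}e^{-\lambda n}$, the infimum over at most countable families of centers $x\in\mathcal F\subset X$ with integers $n=n(x)\ge N$ such that $Y\subset\bigcup_{x\in\mathcal F}B_n^+(x,G_1,\varepsilon)$; $m^+(Y,\lambda,\varepsilon)=\lim_{N\to\infty}M^+(Y,\lambda,N,\varepsilon)$; $h^+(Y,G_1,\varepsilon)=\inf\{\lambda:m^+(Y,\lambda,\varepsilon)=0\}$; $h^+(Y,G_1)=\lim_{\varepsilon\to0}h^+(Y,G_1,\varepsilon)$. *)

theory Defs
  imports "HOL-Probability.Probability"
begin

text \<open>A map on a compact set \<open>X\<close> is of class \<open>C\<^sup>1\<close> if it is the restriction to \<open>X\<close> of a map that is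
  \<open>C\<^sup>1\<close> on an open neighbourhood of \<open>X\<close>; \<open>Df\<close> is the derivative of that extension. (A derivative
  taken within \<open>X\<close> would be meaningless at isolated points.)\<close>

definition C1_on ::
  "(real ^ 'd) set \<Rightarrow> (real ^ 'd \<Rightarrow> real ^ 'd) \<Rightarrow> (real ^ 'd \<Rightarrow> (real ^ 'd) \<Rightarrow>\<^sub>L (real ^ 'd)) \<Rightarrow> bool"
  where "C1_on X f Df \<longleftrightarrow>
    (\<exists>U g. open U \<and> X \<subseteq> U \<and> (\<forall>x\<in>X. g x = f x) \<and>
       (\<forall>x\<in>U. (g has_derivative blinfun_apply (Df x)) (at x)) \<and> continuous_on U Df)"

definition conformal_expanding_on ::
  "(real ^ 'd) set \<Rightarrow> nat \<Rightarrow> (nat \<Rightarrow> real ^ 'd \<Rightarrow> real ^ 'd) \<Rightarrow> bool"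
  where "conformal_expanding_on X m f \<longleftrightarrow>
    (\<exists>\<gamma>>1. \<forall>j\<in>{1..m}. \<exists>Df (a :: real ^ 'd \<Rightarrow> real) A. C1_on X (f j) Df \<and>
       (\<forall>x\<in>X. linear (A x) \<and> (\<forall>v. norm (A x v) = norm v) \<and>
          (\<forall>v. blinfun_apply (Df x) v = a x *\<^sub>R A x v) \<and> \<bar>a x\<bar> > \<gamma>))"

text \<open>\<open>word_map f [j\<^sub>1, \<dots>, j\<^sub>n] = f j\<^sub>1 \<circ> \<dots> \<circ> f j\<^sub>n\<close>\<close>

definition word_map :: "(nat \<Rightarrow> 'a \<Rightarrow> 'a) \<Rightarrow> nat list \<Rightarrow> 'a \<Rightarrow> 'a"
  where "word_map f w = foldr (\<lambda>j g. f j \<circ> g) w id"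

definition words :: "nat \<Rightarrow> nat \<Rightarrow> nat list set"
  where "words m n = {C. length C = n \<and> set C \<subseteq> {1..m}}"

definition bowen_ball ::
  "'a::metric_space set \<Rightarrow> (nat \<Rightarrow> 'a \<Rightarrow> 'a) \<Rightarrow> 'a \<Rightarrow> nat list \<Rightarrow> real \<Rightarrow> 'a set"
  where "bowen_ball X f y C \<epsilon> =
    {z \<in> X. dist y z < \<epsilon> \<and>
       (\<forall>k\<in>{1..length C}.
          dist (word_map f (rev (take k C)) y) (word_map f (rev (take k C)) z) < \<epsilon>)}"

definition exhaustive_ball ::
  "'a::metric_space set \<Rightarrow> nat \<Rightarrow> (nat \<Rightarrow> 'a \<Rightarrow> 'a) \<Rightarrow> nat \<Rightarrow> 'a \<Rightarrow> real \<Rightarrow> 'a set"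
  where "exhaustive_ball X m f n x \<epsilon> = (\<Union>C\<in>words m n. bowen_ball X f x C \<epsilon>)"

definition log_inverse :: "real \<Rightarrow> ereal"
  where "log_inverse p = (if p = 0 then \<infinity> else ereal (ln (inverse p)))"

text \<open>All limits below are limits of monotone functions with values in a complete linear order,
  so they exist (for the local entropy: when the exhaustive balls are \<open>\<mu>\<close>-measurable, which holds
  for continuous \<open>f j : X \<rightarrow> X\<close>).\<close>

definition local_exhaustive_entropy ::
  "'a::metric_space set \<Rightarrow> nat \<Rightarrow> (nat \<Rightarrow> 'a \<Rightarrow> 'a) \<Rightarrow> 'a measure \<Rightarrow> 'a \<Rightarrow> ereal"
  where "local_exhaustive_entropy X m f \<mu> x =
    Lim (at_right 0)
      (\<lambda>\<epsilon>. liminf (\<lambda>n. log_inverse (measure \<mu> (exhaustive_ball X m f n x \<epsilon>)) / ereal (real n)))"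

definition exhaustive_M ::
  "'a::metric_space set \<Rightarrow> nat \<Rightarrow> (nat \<Rightarrow> 'a \<Rightarrow> 'a) \<Rightarrow> 'a set \<Rightarrow> real \<Rightarrow> nat \<Rightarrow> real \<Rightarrow> ennreal"
  where "exhaustive_M X m f Y l N \<epsilon> =
    (INF (F, n) \<in> {(F, n). countable F \<and> F \<subseteq> X \<and> (\<forall>x\<in>F. N \<le> n x) \<and>
                      Y \<subseteq> (\<Union>x\<in>F. exhaustive_ball X m f (n x) x \<epsilon>)}.
       \<Sum>\<^sub>\<infinity>x\<in>F. ennreal (exp (- l * real (n x))))"

definition exhaustive_m ::
  "'a::metric_space set \<Rightarrow> nat \<Rightarrow> (nat \<Rightarrow> 'a \<Rightarrow> 'a) \<Rightarrow> 'a set \<Rightarrow> real \<Rightarrow> real \<Rightarrow> ennreal"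
  where "exhaustive_m X m f Y l \<epsilon> = lim (\<lambda>N. exhaustive_M X m f Y l N \<epsilon>)"

definition exhaustive_entropy_at ::
  "'a::metric_space set \<Rightarrow> nat \<Rightarrow> (nat \<Rightarrow> 'a \<Rightarrow> 'a) \<Rightarrow> 'a set \<Rightarrow> real \<Rightarrow> ereal"
  where "exhaustive_entropy_at X m f Y \<epsilon> = (INF l \<in> {l. exhaustive_m X m f Y l \<epsilon> = 0}. ereal l)"

definition exhaustive_entropy ::
  "'a::metric_space set \<Rightarrow> nat \<Rightarrow> (nat \<Rightarrow> 'a \<Rightarrow> 'a) \<Rightarrow> 'a set \<Rightarrow> ereal"
  where "exhaustive_entropy X m f Y = Lim (at_right 0) (exhaustive_entropy_at X m f Y)"

end

theory Submission imports Defs begin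

text \<open>
  On a sufficiently small scale \<open>\<epsilon>\<close> each \<open>f j\<close> multiplies distances near \<open>x\<close> by \<open>\<parallel>Df j x\<parallel>\<close>, up to a
  factor in \<open>[1 - \<eta>, 1 + \<eta>]\<close>. Hence an exhaustive ball of order \<open>n\<close> lies between Euclidean balls of
  radii \<open>r\<close> and \<open>\<rho>\<^sup>n r\<close>, where \<open>\<rho> = (1 + \<eta>) / (1 - \<eta>)\<close> is close to \<open>1\<close>.

  For \<open>\<beta> > \<alpha>\<close>, every point of \<open>Y\<close> belongs, for infinitely many \<open>n\<close>, to the set \<open>A n\<close> of points whose
  exhaustive ball of order \<open>n\<close> has measure more than \<open>e\<^bsup>-\<beta>n\<^esup>\<close>. Split \<open>A n\<close> according to the dyadic size of \<open>r\<close>;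
  there are only \<open>O(n)\<close> classes. In a class, take a maximal set of centres separated by the inner
  radius: their inner balls cover the class, while their outer balls overlap at most \<open>(1 + 4\<rho>\<^sup>n)\<^sup>D\<close>
  times by comparison of volumes, so there are at most \<open>(1 + 4\<rho>\<^sup>n)\<^sup>D e\<^bsup>\<beta>n\<^esup>\<close> of them. For \<open>l > \<beta>\<close> and \<open>\<eta>\<close> small
  the resulting covers have summable weights \<open>e\<^bsup>-ln\<^esup>\<close>.
\<close>


subsection \<open>Monotone limits and separated sets\<close>

lemma antimono_tendsto_at_right:
  fixes g :: "real \<Rightarrow> 'a :: {complete_linorder, linorder_topology}"
  assumes "\<And>a b. 0 < a \<Longrightarrow> a \<le> b \<Longrightarrow> g b \<le> g a"
  shows "(g \<longlongrightarrow> (SUP e\<in>{0<..}. g e)) (at_right 0)"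
proof (rule order_tendstoI)
  fix y assume "y < (SUP e\<in>{0<..}. g e)"
  then obtain e where e: "0 < e" "y < g e"
    by (auto simp: less_SUP_iff)
  have "eventually (\<lambda>x. x \<in> {0<..<e}) (at_right 0)"
    using e(1) by (rule eventually_at_right_real)
  then show "eventually (\<lambda>x. y < g x) (at_right 0)"
    by eventually_elim (use e assms in \<open>auto intro: less_le_trans\<close>)
next
  fix y assume y: "(SUP e\<in>{0<..}. g e) < y"
  show "eventually (\<lambda>x. g x < y) (at_right 0)"
    using eventually_at_right_less[of 0]
    by eventually_elim (use y in \<open>auto intro: le_less_trans[OF SUP_upper]\<close>)
qed

text \<open>Both entropies can only grow as the scale shrinks, so their limits are suprema. A bound
  on the local entropy thus holds at every scale, and the exhaustive entropy can be bounded scale by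
  scale.\<close>

lemma Lim_at_right_antimono:
  fixes g :: "real \<Rightarrow> 'a :: {complete_linorder, linorder_topology}"
  assumes "\<And>a b. 0 < a \<Longrightarrow> a \<le> b \<Longrightarrow> g b \<le> g a"
  shows "Lim (at_right 0) g = (SUP e\<in>{0<..}. g e)"
  using antimono_tendsto_at_right[of g] assms by (intro tendsto_Lim) auto

section \<open>Packing bounds and covers by maximal separated sets\<close>

text \<open>Volume comparison: balls of radius \<open>r/2\<close> around separated points are
  disjoint, and all of them fit into the ball of radius \<open>R + r/2\<close>.\<close>

lemma card_separated_le:
  fixes T :: "'a :: euclidean_space set"
  assumes "finite T" "T \<subseteq> ball z R" "0 < r" "0 \<le> R"
    and sep: "\<And>x y. x \<in> T \<Longrightarrow> y \<in> T \<Longrightarrow> x \<noteq> y \<Longrightarrow> r \<le> dist x y"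
  shows "real (card T) \<le> (1 + 2 * R / r) ^ DIM('a)"
proof -
  let ?v = "unit_ball_vol DIM('a)"
  have v: "?v > 0" by simp
  have disj: "disjoint_family_on (\<lambda>x. ball x (r/2)) T"
    unfolding disjoint_family_on_def
  proof (intro ballI impI)
    fix x y assume xy: "x \<in> T" "y \<in> T" "x \<noteq> y"
    show "ball x (r/2) \<inter> ball y (r/2) = {}"
    proof (rule ccontr)
      assume "ball x (r/2) \<inter> ball y (r/2) \<noteq> {}"
      then obtain z where "dist x z < r/2" "dist y z < r/2" by auto
      then show False using dist_triangle2[of x y z] sep[OF xy] by simp
    qed
  qed
  have "real (card T) * (?v * (r/2) ^ DIM('a)) = (\<Sum>x\<in>T. measure lborel (ball x (r/2)))"
    using assms by (simp add: content_ball)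
  also have "\<dots> = measure lborel (\<Union>x\<in>T. ball x (r/2))"
    using assms(1) disj less_imp_neq[OF emeasure_lborel_ball_finite]
    by (intro measure_finite_Union[symmetric]) auto
  also have "\<dots> \<le> measure lborel (ball z (R + r/2))"
  proof (rule measure_mono_fmeasurable)
    show "(\<Union>x\<in>T. ball x (r/2)) \<subseteq> ball z (R + r/2)"
    proof clarify
      fix x y assume "x \<in> T" "y \<in> ball x (r/2)"
      moreover from this have "dist z x < R" using assms by auto
      ultimately show "y \<in> ball z (R + r/2)"
        using dist_triangle[of z y x] by simp
    qed
    show "ball z (R + r/2) \<in> fmeasurable lborel"
      using emeasure_lborel_ball_finite by (intro fmeasurableI) auto
    show "(\<Union>x\<in>T. ball x (r/2)) \<in> sets lborel"
      unfolding sets_lborel by (intro borel_open) auto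
  qed
  also have "\<dots> = ?v * (R + r/2) ^ DIM('a)"
    using assms by (simp add: content_ball)
  finally have "?v * (real (card T) * (r/2) ^ DIM('a)) \<le> ?v * (R + r/2) ^ DIM('a)"
    by (simp only: mult_ac)
  then have "real (card T) * (r/2) ^ DIM('a) \<le> (R + r/2) ^ DIM('a)"
    using v by (subst (asm) mult_le_cancel_left_pos) auto
  then have "real (card T) \<le> (R + r/2) ^ DIM('a) / (r/2) ^ DIM('a)"
    using \<open>0 < r\<close> by (simp add: pos_le_divide_eq)
  also have "\<dots> = ((R + r/2) / (r/2)) ^ DIM('a)" by (simp only: power_divide)
  also have "(R + r/2) / (r/2) = 1 + 2 * R / r"
    using \<open>0 < r\<close> by (simp add: field_simps)
  finally show ?thesis .
qed

text \<open>Double counting. The total mass of the balls of radius \<open>R\<close> is the integral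
  of the number of balls that contain \<open>z\<close>. That number counts separated centres in
  \<open>ball z R\<close>, so volume comparison bounds it, and the total mass of \<open>M\<close> is
  1.\<close>

lemma card_separated_measure_le:
  fixes T X :: "'a :: euclidean_space set"
  assumes M: "prob_space M" "sets M = sets (restrict_space borel X)"
    and T: "finite T" and r: "0 < r" "0 \<le> R" and "0 < c"
    and sep: "\<And>x y. x \<in> T \<Longrightarrow> y \<in> T \<Longrightarrow> x \<noteq> y \<Longrightarrow> r \<le> dist x y"
    and mass: "\<And>x. x \<in> T \<Longrightarrow> c \<le> measure M (X \<inter> ball x R)"
  shows "real (card T) \<le> (1 + 2 * R / r) ^ DIM('a) / c"
proof -
  interpret prob_space M by fact
  have meas: "X \<inter> ball x R \<in> sets M" for x
    unfolding M(2) by (auto simp: sets_restrict_space)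
  have "real (card T) * c \<le> (\<Sum>x\<in>T. measure M (X \<inter> ball x R))"
    using sum_mono[of T "\<lambda>_. c", OF mass] by simp
  also have "\<dots> = (\<integral>z. (\<Sum>x\<in>T. indicator (X \<inter> ball x R) z) \<partial>M)"
    using meas by (subst Bochner_Integration.integral_sum)
      (auto simp: Int_absorb2 sets.sets_into_space integrable_indicator_iff emeasure_eq_measure)
  also have "\<dots> \<le> (\<integral>z. (1 + 2 * R / r) ^ DIM('a) \<partial>M)"
  proof (rule integral_mono)
    fix z
    have "(\<Sum>x\<in>T. indicator (X \<inter> ball x R) z :: real) \<le> (\<Sum>x\<in>T. if x \<in> ball z R then 1 else 0)"
      by (intro sum_mono) (auto simp: indicator_def dist_commute)
    also have "\<dots> = real (card (T \<inter> ball z R))"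
      using T by (simp add: sum.If_cases ball_def)
    also have "\<dots> \<le> (1 + 2 * R / r) ^ DIM('a)"
      using T r sep by (intro card_separated_le[where z = z]) auto
    finally show "(\<Sum>x\<in>T. indicator (X \<inter> ball x R) z :: real) \<le> (1 + 2 * R / r) ^ DIM('a)" .
  qed (use meas in \<open>auto simp: Int_absorb2 sets.sets_into_space integrable_indicator_iff emeasure_eq_measure\<close>)
  also have "\<dots> = (1 + 2 * R / r) ^ DIM('a)"
    by (simp add: prob_space)
  finally show ?thesis
    using \<open>0 < c\<close> by (simp add: pos_le_divide_eq)
qed

text \<open>A separated set of greatest cardinality covers: a point at distance at least
  \<open>r\<close> from all its members could be added to it.\<close>

lemma finite_cover_of_mass:
  fixes A X :: "'a :: euclidean_space set"
  assumes M: "prob_space M" "sets M = sets (restrict_space borel X)"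
    and r: "0 < r" "0 \<le> R" and "0 < c"
    and mass: "\<And>x. x \<in> A \<Longrightarrow> c \<le> measure M (X \<inter> ball x R)"
  obtains S where "finite S" "S \<subseteq> A" "real (card S) \<le> (1 + 2 * R / r) ^ DIM('a) / c"
    "A \<subseteq> (\<Union>x\<in>S. ball x r)"
proof -
  define \<S> where "\<S> = {T. finite T \<and> T \<subseteq> A \<and> (\<forall>x\<in>T. \<forall>y\<in>T. x \<noteq> y \<longrightarrow> r \<le> dist x y)}"
  let ?B = "(1 + 2 * R / r) ^ DIM('a) / c"
  have bound: "real (card T) \<le> ?B" if "T \<in> \<S>" for T
    using that mass by (intro card_separated_measure_le[OF M _ r \<open>0 < c\<close>]) (auto simp: \<S>_def)
  have "{} \<in> \<S>" by (simp add: \<S>_def)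
  \<comment> \<open>The packing bound is uniform over all separated subsets, so the greatest
    cardinality is attained even when \<open>A\<close> is infinite.\<close>
  moreover have "\<forall>T. T \<in> \<S> \<longrightarrow> card T < Suc (nat \<lfloor>?B\<rfloor>)"
    using bound by (auto simp: le_nat_floor less_Suc_eq_le)
  ultimately obtain S where S: "S \<in> \<S>" and max: "\<And>T. T \<in> \<S> \<Longrightarrow> card T \<le> card S"
    using ex_has_greatest_nat[of "\<lambda>T. T \<in> \<S>" "{}" card] by metis
  have "A \<subseteq> (\<Union>x\<in>S. ball x r)"
  proof
    fix y assume y: "y \<in> A"
    show "y \<in> (\<Union>x\<in>S. ball x r)"
    proof (rule ccontr)
      assume far: "y \<notin> (\<Union>x\<in>S. ball x r)"
      then have "insert y S \<in> \<S>"
        using S y by (auto simp: \<S>_def dist_commute not_less)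
      moreover have "y \<notin> S" using far r by auto
      ultimately show False
        using max[of "insert y S"] S by (auto simp: \<S>_def)
    qed
  qed
  with S bound[OF S] that show thesis by (auto simp: \<S>_def)
qed

subsection \<open>Distance distortion of conformal maps\<close>

text \<open>Mean value inequality for \<open>g\<close> minus its linear part at \<open>x\<close>;
  compactness of \<open>X\<close> makes the radius independent of \<open>x\<close>.\<close>

lemma C1_on_uniform_estimate:
  assumes "compact X" "C1_on X f Df" "0 < \<eta>"
  obtains \<delta> where "0 < \<delta>"
    "\<And>x z. x \<in> X \<Longrightarrow> z \<in> X \<Longrightarrow> dist x z < \<delta> \<Longrightarrow>
       norm (f z - f x - blinfun_apply (Df x) (z - x)) \<le> \<eta> * norm (z - x)"
proof -
  obtain U g where U: "open U" "X \<subseteq> U" and g: "\<And>x. x \<in> X \<Longrightarrow> g x = f x"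
    and der: "\<And>x. x \<in> U \<Longrightarrow> (g has_derivative blinfun_apply (Df x)) (at x)"
    and cont: "continuous_on U Df"
    using assms(2) unfolding C1_on_def by blast
  \<comment> \<open>On each \<open>V w\<close> the derivative stays within \<eta>/2 of
    \<open>Df w\<close>, hence varies by at most \<eta>. The radius \<delta> is a Lebesgue number of
    this cover of \<open>X\<close>.\<close>
  define V where "V x = U \<inter> Df -` ball (Df x) (\<eta>/2)" for x
  have "open (V x)" for x
    unfolding V_def using continuous_open_preimage[OF cont U(1)] by simp
  moreover have "X \<subseteq> \<Union> (V ` X)"
    using U \<open>0 < \<eta>\<close> by (auto simp: V_def)
  ultimately obtain \<delta> where \<delta>: "0 < \<delta>" "\<forall>x\<in>X. \<exists>B\<in>V ` X. ball x \<delta> \<subseteq> B"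
    using Heine_Borel_lemma[OF assms(1), of "V ` X"] by (metis imageE)
  show thesis
  proof (rule that[OF \<delta>(1)])
    fix x z assume x: "x \<in> X" and z: "z \<in> X" "dist x z < \<delta>"
    obtain w where w: "ball x \<delta> \<subseteq> V w"
      using \<delta>(2) x by blast
    have xV: "x \<in> V w" using w \<delta>(1) by auto
    \<comment> \<open>The segment from \<open>x\<close> to \<open>z\<close> may leave
      \<open>X\<close>. The inequality is therefore applied to the extension \<open>g\<close> on the
      convex set \<open>ball x \<delta>\<close>, which lies in \<open>U\<close>.\<close>
    have "norm ((\<lambda>y. g y - blinfun_apply (Df x) y) z - (\<lambda>y. g y - blinfun_apply (Df x) y) x)
        \<le> \<eta> * norm (z - x)"
    proof (rule differentiable_bound[of "ball x \<delta>" _ "\<lambda>y. blinfun_apply (Df y - Df x)"])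
      fix y assume y: "y \<in> ball x \<delta>"
      then have yV: "y \<in> V w" using w by auto
      have "(g has_derivative blinfun_apply (Df y)) (at y within ball x \<delta>)"
        using yV der by (simp add: V_def has_derivative_at_withinI)
      moreover have "blinfun_apply (Df y - Df x) = (\<lambda>v. blinfun_apply (Df y) v - blinfun_apply (Df x) v)"
        by (simp add: fun_eq_iff blinfun.diff_left)
      ultimately show "((\<lambda>y. g y - blinfun_apply (Df x) y) has_derivative blinfun_apply (Df y - Df x)) (at y within ball x \<delta>)"
        by (simp add: has_derivative_diff bounded_linear_imp_has_derivative blinfun.bounded_linear_right)
      have "dist (Df y) (Df x) \<le> dist (Df w) (Df y) + dist (Df w) (Df x)"
        by (rule dist_triangle3)
      also have "\<dots> \<le> \<eta>" using xV yV by (simp add: V_def)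
      finally show "onorm (blinfun_apply (Df y - Df x)) \<le> \<eta>"
        by (simp add: dist_norm norm_blinfun.rep_eq)
    qed (use z \<delta>(1) in auto)
    then show "norm (f z - f x - blinfun_apply (Df x) (z - x)) \<le> \<eta> * norm (z - x)"
      using g x z by (simp add: blinfun.diff_right algebra_simps)
  qed
qed

lemma C1_on_imp_continuous_on:
  assumes "C1_on X f Df" shows "continuous_on X f"
proof -
  obtain U g where "X \<subseteq> U" and g: "\<And>x. x \<in> X \<Longrightarrow> g x = f x"
    and der: "\<And>x. x \<in> U \<Longrightarrow> (g has_derivative blinfun_apply (Df x)) (at x)"
    using assms unfolding C1_on_def by blast
  then have "continuous_on X g"
    by (intro continuous_at_imp_continuous_on) (auto intro: has_derivative_continuous)
  then show ?thesis using g by (rule continuous_on_eq)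
qed

lemma conformal_norm:
  fixes D :: "(real ^ 'd) \<Rightarrow>\<^sub>L (real ^ 'd)"
  assumes "\<And>v. blinfun_apply D v = a *\<^sub>R A v" "\<And>v. norm (A v) = norm v"
  shows "norm D = \<bar>a\<bar>" "norm (blinfun_apply D v) = \<bar>a\<bar> * norm v"
proof -
  show "norm (blinfun_apply D v) = \<bar>a\<bar> * norm v" for v using assms by simp
  \<comment> \<open>For the lower bound on the operator norm one unit vector suffices; any
    coordinate axis will do.\<close>
  then show "norm D = \<bar>a\<bar>"
    by (intro antisym norm_blinfun_bound)
      (use norm_blinfun[of D "axis undefined 1"] in auto)
qed

text \<open>The factor \<open>b j x\<close> is the operator norm of the derivative. By conformality
  it is the stretching in every direction, so a single number controls distances from both
  sides.\<close>

lemma conformal_expanding_estimate: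
  fixes f :: "nat \<Rightarrow> real ^ 'd \<Rightarrow> real ^ 'd"
  assumes "compact X" "conformal_expanding_on X m f"
  obtains b L where "\<And>j x. j \<in> {1..m} \<Longrightarrow> x \<in> X \<Longrightarrow> 1 \<le> b j x" "\<And>j x. j \<in> {1..m} \<Longrightarrow> x \<in> X \<Longrightarrow> b j x \<le> L"
    "1 \<le> L"
    "\<And>\<eta>. 0 < \<eta> \<Longrightarrow> \<exists>\<delta>>0. \<forall>j\<in>{1..m}. \<forall>x\<in>X. \<forall>z\<in>X. dist x z < \<delta> \<longrightarrow>
       (1 - \<eta>) * b j x * dist x z \<le> dist (f j x) (f j z) \<and>
       dist (f j x) (f j z) \<le> (1 + \<eta>) * b j x * dist x z"
proof -
  obtain \<gamma> where \<gamma>: "\<gamma> > 1" and ex: "\<forall>j\<in>{1..m}. \<exists>Df (a :: real ^ 'd \<Rightarrow> real) A. C1_on X (f j) Df \<and>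
       (\<forall>x\<in>X. linear (A x) \<and> (\<forall>v. norm (A x v) = norm v) \<and>
          (\<forall>v. blinfun_apply (Df x) v = a x *\<^sub>R A x v) \<and> \<bar>a x\<bar> > \<gamma>)"
    using assms(2) unfolding conformal_expanding_on_def by blast
  have "\<exists>Df. C1_on X (f j) Df \<and> (\<forall>x\<in>X. 1 \<le> norm (Df x) \<and>
           (\<forall>v. norm (blinfun_apply (Df x) v) = norm (Df x) * norm v))" if j: "j \<in> {1..m}" for j
  proof -
    obtain Df a A where 1: "C1_on X (f j) Df" and 2: "\<And>x. x \<in> X \<Longrightarrow> (\<forall>v. norm (A x v) = norm v) \<and>
          (\<forall>v. blinfun_apply (Df x) v = a x *\<^sub>R A x v) \<and> \<bar>a x\<bar> > \<gamma>"
      using bspec[OF ex j] by blast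
    have "1 \<le> norm (Df x) \<and> (\<forall>v. norm (blinfun_apply (Df x) v) = norm (Df x) * norm v)" if "x \<in> X" for x
      using conformal_norm[of "Df x" "a x" "A x"] 2[OF that] \<gamma> by auto
    with 1 show ?thesis by blast
  qed
  then obtain Df where C1: "\<And>j. j \<in> {1..m} \<Longrightarrow> C1_on X (f j) (Df j)"
    and ge1: "\<And>j x. j \<in> {1..m} \<Longrightarrow> x \<in> X \<Longrightarrow> 1 \<le> norm (Df j x)"
    and conf: "\<And>j x v. j \<in> {1..m} \<Longrightarrow> x \<in> X \<Longrightarrow> norm (blinfun_apply (Df j x) v) = norm (Df j x) * norm v"
    by metis
  have "\<exists>B. \<forall>x\<in>X. norm (Df j x) \<le> B" if "j \<in> {1..m}" for j
  proof -
    have "continuous_on X (Df j)"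
      using C1[OF that] continuous_on_subset unfolding C1_on_def by blast
    from compact_continuous_image[OF this assms(1)] show ?thesis
      by (auto dest!: compact_imp_bounded simp: bounded_iff)
  qed
  then obtain B where B: "\<And>j x. j \<in> {1..m} \<Longrightarrow> x \<in> X \<Longrightarrow> norm (Df j x) \<le> B j" by metis
  \<comment> \<open>Inserting 1 keeps the maximum defined for \<open>m = 0\<close> and gives
    \<open>1 \<le> L\<close>; the minimum \<open>d\<close> below is treated likewise.\<close>
  define L where "L = Max (insert 1 (B ` {1..m}))"
  show thesis
  proof (rule that[of "\<lambda>j x. norm (Df j x)" L])
    show "norm (Df j x) \<le> L" if "j \<in> {1..m}" "x \<in> X" for j x
      using B[OF that] that unfolding L_def by (intro order.trans[OF _ Max_ge]) auto
    show "1 \<le> L" by (simp add: L_def)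
    fix \<eta> :: real assume \<eta>: "0 < \<eta>"
    have "\<exists>\<delta>>0. \<forall>x\<in>X. \<forall>z\<in>X. dist x z < \<delta> \<longrightarrow>
       norm (f j z - f j x - blinfun_apply (Df j x) (z - x)) \<le> \<eta> * norm (z - x)" if "j \<in> {1..m}" for j
      using C1_on_uniform_estimate[OF assms(1) C1[OF that] \<eta>] by metis
    then obtain \<delta> where \<delta>: "\<And>j. j \<in> {1..m} \<Longrightarrow> \<delta> j > 0"
      "\<And>j x z. j \<in> {1..m} \<Longrightarrow> x \<in> X \<Longrightarrow> z \<in> X \<Longrightarrow> dist x z < \<delta> j \<Longrightarrow>
       norm (f j z - f j x - blinfun_apply (Df j x) (z - x)) \<le> \<eta> * norm (z - x)"
      by metis
    define d where "d = Min (insert 1 (\<delta> ` {1..m}))"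
    have "d > 0" unfolding d_def using \<delta> by (subst Min_gr_iff) auto
    moreover have "(1 - \<eta>) * norm (Df j x) * dist x z \<le> dist (f j x) (f j z) \<and>
       dist (f j x) (f j z) \<le> (1 + \<eta>) * norm (Df j x) * dist x z"
      if j: "j \<in> {1..m}" and x: "x \<in> X" and z: "z \<in> X" "dist x z < d" for j x z
    proof -
      have "d \<le> \<delta> j" unfolding d_def using j by (intro Min_le) auto
      then have "norm (f j z - f j x - blinfun_apply (Df j x) (z - x)) \<le> \<eta> * norm (z - x)"
        using \<delta>(2)[OF j x z(1)] z by simp
      \<comment> \<open>The derivative norm is at least 1, so an error proportional to the distance
        is also one proportional to the expanded distance.\<close>
      also have "\<dots> \<le> \<eta> * (norm (Df j x) * norm (z - x))"
        using \<eta> ge1[OF j x] by (intro mult_left_mono) (auto simp: mult_le_cancel_right1)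
      finally have "norm (f j z - f j x - blinfun_apply (Df j x) (z - x)) \<le> \<eta> * (norm (Df j x) * norm (z - x))" .
      moreover have "norm (blinfun_apply (Df j x) (z - x)) = norm (Df j x) * norm (z - x)"
        by (rule conf[OF j x])
      moreover have "dist (f j x) (f j z) = norm (f j z - f j x)" "dist x z = norm (z - x)"
        by (simp_all add: dist_norm norm_minus_commute)
      ultimately show ?thesis
        using norm_triangle_sub[of "f j z - f j x" "blinfun_apply (Df j x) (z - x)"]
          norm_triangle_sub[of "blinfun_apply (Df j x) (z - x)" "f j z - f j x"]
        by (simp add: algebra_simps norm_minus_commute)
    qed
    ultimately show "\<exists>\<delta>>0. \<forall>j\<in>{1..m}. \<forall>x\<in>X. \<forall>z\<in>X. dist x z < \<delta> \<longrightarrow>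
       (1 - \<eta>) * norm (Df j x) * dist x z \<le> dist (f j x) (f j z) \<and>
       dist (f j x) (f j z) \<le> (1 + \<eta>) * norm (Df j x) * dist x z"
      by blast
  qed (rule ge1)
qed


subsection \<open>Bowen balls and exhaustive balls\<close>

lemma word_map_snoc: "word_map f (u @ [j]) x = word_map f u (f j x)"
  by (induction u) (simp_all add: word_map_def)

lemma bowen_ball_Nil: "bowen_ball X f y [] \<epsilon> = X \<inter> ball y \<epsilon>"
  by (auto simp: bowen_ball_def)

text \<open>The first letter of a word acts first. After one step the remaining conditions are those
  of the tail at \<open>f j y\<close>, which permits induction on words.\<close>

lemma bowen_ball_Cons:
  assumes "f j ` X \<subseteq> X"
  shows "bowen_ball X f y (j # C) \<epsilon> = (X \<inter> ball y \<epsilon>) \<inter> (X \<inter> f j -` bowen_ball X f (f j y) C \<epsilon>)"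
proof -
  let ?d = "\<lambda>C k y z. dist (word_map f (rev (take k C)) y) (word_map f (rev (take k C)) z)"
  \<comment> \<open>For \<open>k = 0\<close> the map is the identity, so the separate condition on
    \<open>dist y z\<close> joins the family and the index can be shifted.\<close>
  have upto: "bowen_ball X f y C \<epsilon> = {z \<in> X. \<forall>k\<in>{..length C}. ?d C k y z < \<epsilon>}" for y C
  proof -
    have "{..length C} = insert 0 {1..length C}" by auto
    then show ?thesis by (simp add: bowen_ball_def word_map_def)
  qed
  have "(\<forall>k\<in>{..length (j # C)}. ?d (j # C) k y z < \<epsilon>) \<longleftrightarrow>
      dist y z < \<epsilon> \<and> (\<forall>k\<in>{..length C}. ?d C k (f j y) (f j z) < \<epsilon>)" for z
  proof -
    have "{..length (j # C)} = insert 0 (Suc ` {..length C})"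
      by (simp add: atMost_Suc_eq_insert_0)
    then have "(\<forall>k\<in>{..length (j # C)}. P k) \<longleftrightarrow> P 0 \<and> (\<forall>k\<in>{..length C}. P (Suc k))" for P by simp
    from this[of "\<lambda>k. ?d (j # C) k y z < \<epsilon>"] show ?thesis
      by (simp add: word_map_snoc) (simp add: word_map_def)
  qed
  with assms show ?thesis unfolding upto by auto
qed

lemma openin_bowen_ball:
  assumes "\<And>j. j \<in> {1..m} \<Longrightarrow> f j ` X \<subseteq> X" "\<And>j. j \<in> {1..m} \<Longrightarrow> continuous_on X (f j)"
    "set C \<subseteq> {1..m}"
  shows "openin (top_of_set X) (bowen_ball X f y C \<epsilon>)"
  using assms(3)
proof (induction C arbitrary: y)
  case Nil
  then show ?case by (simp add: bowen_ball_Nil openin_open_Int)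
next
  case (Cons j C)
  then have j: "j \<in> {1..m}" by simp
  have "openin (top_of_set X) (X \<inter> f j -` bowen_ball X f (f j y) C \<epsilon>)"
    using assms(1,2)[OF j] Cons by (intro continuous_openin_preimage[where T = X]) auto
  then show ?case
    unfolding bowen_ball_Cons[where f = f, OF assms(1)[OF j]] by (rule openin_Int[OF openin_open_Int[OF open_ball]])
qed

text \<open>Measurability allows the masses of exhaustive balls at two scales to be compared by
  monotonicity.\<close>

lemma exhaustive_ball_measurable:
  fixes f :: "nat \<Rightarrow> 'a :: metric_space \<Rightarrow> 'a"
  assumes "\<And>j. j \<in> {1..m} \<Longrightarrow> f j ` X \<subseteq> X" "\<And>j. j \<in> {1..m} \<Longrightarrow> continuous_on X (f j)"
  shows "exhaustive_ball X m f n x \<epsilon> \<in> sets (restrict_space borel X)"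
proof -
  have "openin (top_of_set X) (exhaustive_ball X m f n x \<epsilon>)"
    unfolding exhaustive_ball_def
  proof (rule openin_Union, clarify)
    fix C assume "C \<in> words m n"
    then show "openin (top_of_set X) (bowen_ball X f x C \<epsilon>)"
      by (intro openin_bowen_ball[of m f X, OF assms]) (simp_all add: words_def)
  qed
  then obtain T where "open T" "exhaustive_ball X m f n x \<epsilon> = X \<inter> T"
    unfolding openin_open by blast
  then show ?thesis
    by (simp add: sets_restrict_space)
qed

lemma exhaustive_ball_subset: "exhaustive_ball X m f n x \<epsilon> \<subseteq> X"
  by (auto simp: exhaustive_ball_def bowen_ball_def)

lemma exhaustive_ball_mono:
  assumes "\<epsilon> \<le> \<epsilon>'" shows "exhaustive_ball X m f n x \<epsilon> \<subseteq> exhaustive_ball X m f n x \<epsilon>'"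
  using assms by (force simp: exhaustive_ball_def bowen_ball_def)

text \<open>A prefix of a word imposes fewer conditions than the word itself.\<close>

lemma exhaustive_ball_antimono:
  assumes "n \<le> n'" shows "exhaustive_ball X m f n' x \<epsilon> \<subseteq> exhaustive_ball X m f n x \<epsilon>"
proof
  fix z assume "z \<in> exhaustive_ball X m f n' x \<epsilon>"
  then obtain C where C: "C \<in> words m n'" "z \<in> bowen_ball X f x C \<epsilon>"
    by (auto simp: exhaustive_ball_def)
  have "take n C \<in> words m n"
    using C(1) assms set_take_subset[of n C] by (auto simp: words_def)
  moreover have "z \<in> bowen_ball X f x (take n C) \<epsilon>"
    using C assms by (simp add: bowen_ball_def words_def min_def)
  ultimately show "z \<in> exhaustive_ball X m f n x \<epsilon>"
    by (auto simp: exhaustive_ball_def)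
qed

section \<open>Expansion along words and the Euclidean size of exhaustive balls\<close>

text \<open>The factors are taken at the successive points of the orbit of \<open>x\<close>; to
  first order the product is the stretching at \<open>x\<close> by the composed map.\<close>

fun expansion_along :: "(nat \<Rightarrow> 'a \<Rightarrow> real) \<Rightarrow> (nat \<Rightarrow> 'a \<Rightarrow> 'a) \<Rightarrow> 'a \<Rightarrow> nat list \<Rightarrow> real" where
  "expansion_along b f x [] = 1"
| "expansion_along b f x (j # C) = b j x * expansion_along b f (f j x) C"

lemma expansion_along_ge_1:
  assumes "\<And>j x. j \<in> J \<Longrightarrow> x \<in> X \<Longrightarrow> 1 \<le> b j x"
    "\<And>j. j \<in> J \<Longrightarrow> f j ` X \<subseteq> X" "set C \<subseteq> J" "x \<in> X"
  shows "1 \<le> expansion_along b f x C"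
  using assms(3,4)
proof (induction C arbitrary: x)
  case (Cons j C)
  then have "f j x \<in> X" "1 \<le> b j x" using assms(1,2) by (auto simp: image_subset_iff)
  with Cons have "1 * 1 \<le> b j x * expansion_along b f (f j x) C"
    by (intro mult_mono) auto
  then show ?case by simp
qed simp

lemma expansion_along_le:
  assumes "\<And>j x. j \<in> J \<Longrightarrow> x \<in> X \<Longrightarrow> 1 \<le> b j x" "\<And>j x. j \<in> J \<Longrightarrow> x \<in> X \<Longrightarrow> b j x \<le> L"
    "\<And>j. j \<in> J \<Longrightarrow> f j ` X \<subseteq> X" "set C \<subseteq> J" "x \<in> X"
  shows "expansion_along b f x C \<le> L ^ length C"
  using assms(4,5)
proof (induction C arbitrary: x)
  case (Cons j C)
  then have "f j x \<in> X" "1 \<le> b j x" "b j x \<le> L" using assms(1-3) by (auto simp: image_subset_iff)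
  moreover from this have "1 \<le> expansion_along b f (f j x) C"
    using Cons.prems by (intro expansion_along_ge_1[of J X b f, OF assms(1,3)]) auto
  ultimately have "b j x * expansion_along b f (f j x) C \<le> L * L ^ length C"
    using Cons by (intro mult_mono) auto
  then show ?case by simp
qed simp

text \<open>Inside a Bowen ball the orbits stay closer than \<epsilon>, so the lower estimate
  applies at each step. The factors multiply up to the last distance, which is still below
  \<epsilon>.\<close>

lemma bowen_ball_subset_ball:
  assumes map: "\<And>j. j \<in> J \<Longrightarrow> f j ` X \<subseteq> X" and b: "\<And>j x. j \<in> J \<Longrightarrow> x \<in> X \<Longrightarrow> 1 \<le> b j x"
    and low: "\<And>j x z. j \<in> J \<Longrightarrow> x \<in> X \<Longrightarrow> z \<in> X \<Longrightarrow> dist x z < \<epsilon> \<Longrightarrow> c * b j x * dist x z \<le> dist (f j x) (f j z)"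
    and c: "0 < c" and "set C \<subseteq> J" "x \<in> X" "z \<in> bowen_ball X f x C \<epsilon>"
  shows "dist x z * (c ^ length C * expansion_along b f x C) < \<epsilon>"
  using assms(5-)
proof (induction C arbitrary: x z)
  case Nil
  then show ?case by (simp add: bowen_ball_Nil)
next
  case (Cons j C)
  then have j: "j \<in> J" and x: "x \<in> X" and C: "set C \<subseteq> J" by auto
  have z: "z \<in> X" "dist x z < \<epsilon>" "f j z \<in> bowen_ball X f (f j x) C \<epsilon>"
    using Cons.prems by (auto simp: bowen_ball_Cons[where f = f, OF map[OF j]])
  have fx: "f j x \<in> X" using map j x by blast
  have 1: "1 \<le> expansion_along b f (f j x) C"
    by (rule expansion_along_ge_1[of J X b f, OF b map C fx])
  have "dist x z * (c ^ length (j # C) * expansion_along b f x (j # C))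
      = (c * b j x * dist x z) * (c ^ length C * expansion_along b f (f j x) C)"
    by simp
  also have "\<dots> \<le> dist (f j x) (f j z) * (c ^ length C * expansion_along b f (f j x) C)"
    using low[OF j x z(1,2)] c 1 by (intro mult_right_mono) auto
  also have "\<dots> < \<epsilon>" using Cons.IH[OF C fx z(3)] .
  finally show ?case .
qed

lemma ball_subset_bowen_ball:
  assumes map: "\<And>j. j \<in> J \<Longrightarrow> f j ` X \<subseteq> X" and b: "\<And>j x. j \<in> J \<Longrightarrow> x \<in> X \<Longrightarrow> 1 \<le> b j x"
    and up: "\<And>j x z. j \<in> J \<Longrightarrow> x \<in> X \<Longrightarrow> z \<in> X \<Longrightarrow> dist x z < \<epsilon> \<Longrightarrow> dist (f j x) (f j z) \<le> c * b j x * dist x z"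
    and c: "1 \<le> c" and "set C \<subseteq> J" "x \<in> X" "z \<in> X"
    "dist x z * (c ^ length C * expansion_along b f x C) < \<epsilon>"
  shows "z \<in> bowen_ball X f x C \<epsilon>"
  using assms(5-)
proof (induction C arbitrary: x z)
  case Nil
  then show ?case by (simp add: bowen_ball_Nil)
next
  case (Cons j C)
  then have j: "j \<in> J" and x: "x \<in> X" and z: "z \<in> X" and C: "set C \<subseteq> J" by auto
  have fx: "f j x \<in> X" "f j z \<in> X" using map j x z by auto
  have 1: "1 \<le> expansion_along b f w D" if "w \<in> X" "set D \<subseteq> J" for w D
    using that by (intro expansion_along_ge_1[of J X b f, OF b map])
  \<comment> \<open>All factors are at least 1, so a bound on the predicted final distance already
    bounds the current one. This keeps the upper estimate applicable throughout the
    induction.\<close>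
  have "1 * 1 \<le> c ^ length (j # C) * expansion_along b f x (j # C)"
    using c 1[OF x Cons.prems(1)] by (intro mult_mono one_le_power) auto
  then have "dist x z * 1 \<le> dist x z * (c ^ length (j # C) * expansion_along b f x (j # C))"
    by (intro mult_left_mono) auto
  then have near: "dist x z < \<epsilon>" using Cons.prems(4) by simp
  have "dist (f j x) (f j z) * (c ^ length C * expansion_along b f (f j x) C)
      \<le> (c * b j x * dist x z) * (c ^ length C * expansion_along b f (f j x) C)"
    using up[OF j x z near] c 1[OF fx(1) C] by (intro mult_right_mono) auto
  also have "\<dots> = dist x z * (c ^ length (j # C) * expansion_along b f x (j # C))" by simp
  also have "\<dots> < \<epsilon>" by (rule Cons.prems(4))
  finally have "f j z \<in> bowen_ball X f (f j x) C \<epsilon>"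
    by (rule Cons.IH[OF C fx])
  with near z show ?case by (auto simp: bowen_ball_Cons[where f = f, OF map[OF j]])
qed

lemma finite_words: "finite (words m n)"
proof -
  have "words m n = {C. set C \<subseteq> {1..m} \<and> length C = n}" by (auto simp: words_def)
  then show ?thesis by (simp add: finite_lists_length_eq)
qed

text \<open>The word of least expansion decides the size: its Bowen ball alone contains the inner
  ball, and the Bowen ball of any other word satisfies the same outer bound.\<close>

lemma exhaustive_ball_sandwich:
  fixes f :: "nat \<Rightarrow> 'a :: metric_space \<Rightarrow> 'a"
  assumes map: "\<And>j. j \<in> {1..m} \<Longrightarrow> f j ` X \<subseteq> X"
    and b: "\<And>j x. j \<in> {1..m} \<Longrightarrow> x \<in> X \<Longrightarrow> 1 \<le> b j x" "\<And>j x. j \<in> {1..m} \<Longrightarrow> x \<in> X \<Longrightarrow> b j x \<le> L"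
    and est: "\<And>j x z. j \<in> {1..m} \<Longrightarrow> x \<in> X \<Longrightarrow> z \<in> X \<Longrightarrow> dist x z < \<epsilon> \<Longrightarrow>
       (1 - \<eta>) * b j x * dist x z \<le> dist (f j x) (f j z) \<and>
       dist (f j x) (f j z) \<le> (1 + \<eta>) * b j x * dist x z"
    and \<eta>: "0 < \<eta>" "\<eta> < 1" and \<epsilon>: "0 < \<epsilon>" and ne: "words m n \<noteq> {}" and x: "x \<in> X"
  obtains r where "\<epsilon> / (2 * L) ^ n \<le> r" "r \<le> \<epsilon>"
    "X \<inter> ball x r \<subseteq> exhaustive_ball X m f n x \<epsilon>"
    "exhaustive_ball X m f n x \<epsilon> \<subseteq> X \<inter> ball x (((1 + \<eta>) / (1 - \<eta>)) ^ n * r)"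
proof -
  let ?P = "expansion_along b f x"
  have low: "(1 - \<eta>) * b j x * dist x z \<le> dist (f j x) (f j z)"
    and up: "dist (f j x) (f j z) \<le> (1 + \<eta>) * b j x * dist x z"
    if "j \<in> {1..m}" "x \<in> X" "z \<in> X" "dist x z < \<epsilon>" for j x z
    using est[OF that] by auto
  obtain C where C: "C \<in> words m n" and min: "\<And>C'. C' \<in> words m n \<Longrightarrow> ?P C \<le> ?P C'"
    using arg_min_if_finite[OF finite_words ne, of ?P] not_less by blast
  have PC: "1 \<le> ?P C" "?P C \<le> L ^ n"
    using C x expansion_along_ge_1[of "{1..m}" X b f C x, OF b(1) map]
      expansion_along_le[of "{1..m}" X b L f C x, OF b map]
    by (auto simp: words_def)
  define r where "r = \<epsilon> / ((1 + \<eta>) ^ n * ?P C)"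
  show thesis
  proof (rule that[of r])
    \<comment> \<open>With \<open>r\<close> at least exponentially small in \<open>n\<close>, only
      linearly many dyadic sizes can occur.\<close>
    have "(1 + \<eta>) ^ n * ?P C \<le> 2 ^ n * L ^ n"
      using PC \<eta> by (intro mult_mono power_mono) auto
    then show "\<epsilon> / (2 * L) ^ n \<le> r"
      unfolding r_def power_mult_distrib using \<epsilon> \<eta> PC by (intro divide_left_mono mult_pos_pos) auto
    have "1 * 1 \<le> (1 + \<eta>) ^ n * ?P C"
      using PC \<eta> by (intro mult_mono one_le_power) auto
    then show "r \<le> \<epsilon>"
      unfolding r_def using \<epsilon> by (simp add: divide_le_eq)
    show "X \<inter> ball x r \<subseteq> exhaustive_ball X m f n x \<epsilon>"
    proof clarify
      fix z assume z: "z \<in> X" "z \<in> ball x r"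
      have "dist x z * ((1 + \<eta>) ^ n * ?P C) < \<epsilon>"
        using z \<eta> PC by (simp add: r_def pos_less_divide_eq)
      then have "z \<in> bowen_ball X f x C \<epsilon>"
        using C z(1) x \<eta>
        by (intro ball_subset_bowen_ball[where J = "{1..m}" and f = f and X = X and b = b and c = "1 + \<eta>",
              OF map b(1) up]) (auto simp: words_def)
      then show "z \<in> exhaustive_ball X m f n x \<epsilon>"
        using C by (auto simp: exhaustive_ball_def)
    qed
    show "exhaustive_ball X m f n x \<epsilon> \<subseteq> X \<inter> ball x (((1 + \<eta>) / (1 - \<eta>)) ^ n * r)"
    proof
      fix z assume z: "z \<in> exhaustive_ball X m f n x \<epsilon>"
      then obtain C' where C': "C' \<in> words m n" "z \<in> bowen_ball X f x C' \<epsilon>"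
        by (auto simp: exhaustive_ball_def)
      \<comment> \<open>The word \<open>C'\<close> reaching \<open>z\<close> depends on
        \<open>z\<close>; minimality of \<open>C\<close> replaces it by \<open>C\<close> in the
        bound.\<close>
      have "dist x z * ((1 - \<eta>) ^ n * ?P C) \<le> dist x z * ((1 - \<eta>) ^ n * ?P C')"
        using min[OF C'(1)] \<eta> by (intro mult_left_mono) auto
      also have "\<dots> = dist x z * ((1 - \<eta>) ^ length C' * ?P C')"
        using C'(1) by (simp add: words_def)
      also have "\<dots> < \<epsilon>"
        using C' x \<eta>
        by (intro bowen_ball_subset_ball[where J = "{1..m}" and f = f and X = X and b = b and c = "1 - \<eta>",
              OF map b(1) low]) (auto simp: words_def)
      finally have "dist x z < \<epsilon> / ((1 - \<eta>) ^ n * ?P C)"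
        using \<eta> PC by (simp add: pos_less_divide_eq)
      also have "\<dots> = ((1 + \<eta>) / (1 - \<eta>)) ^ n * r"
        using \<eta> PC by (simp add: r_def power_divide)
      finally show "z \<in> X \<inter> ball x (((1 + \<eta>) / (1 - \<eta>)) ^ n * r)"
        using z exhaustive_ball_subset[of X m f n x \<epsilon>] by auto
    qed
  qed
qed


subsection \<open>Entropy estimates\<close>

text \<open>The liminf at scale \<epsilon> is at most the local entropy, hence below \<beta>, so the
  quotient drops below \<beta> for infinitely many orders.\<close>

lemma local_exhaustive_entropy_le_imp_frequently:
  fixes f :: "nat \<Rightarrow> 'a :: metric_space \<Rightarrow> 'a"
  assumes map: "\<And>j. j \<in> {1..m} \<Longrightarrow> f j ` X \<subseteq> X" and cont: "\<And>j. j \<in> {1..m} \<Longrightarrow> continuous_on X (f j)"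
    and M: "prob_space \<mu>" "sets \<mu> = sets (restrict_space borel X)"
    and le: "local_exhaustive_entropy X m f \<mu> x \<le> ereal \<alpha>" and "\<alpha> < \<beta>" "0 < \<epsilon>"
  obtains n where "N \<le> n" "exp (- \<beta> * real n) < measure \<mu> (exhaustive_ball X m f n x \<epsilon>)"
proof -
  interpret prob_space \<mu> by fact
  define \<phi> where "\<phi> \<epsilon> n = log_inverse (measure \<mu> (exhaustive_ball X m f n x \<epsilon>)) / ereal (real n)" for \<epsilon> n
  have anti: "liminf (\<phi> b) \<le> liminf (\<phi> a)" if "0 < a" "a \<le> b" for a b
  proof (rule Liminf_mono, rule eventually_sequentiallyI[of 1])
    fix n :: nat assume "1 \<le> n"
    have "measure \<mu> (exhaustive_ball X m f n x a) \<le> measure \<mu> (exhaustive_ball X m f n x b)"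
      using exhaustive_ball_mono[OF that(2), of X m f n x] exhaustive_ball_measurable[of m f X, OF map cont]
      by (intro finite_measure_mono) (auto simp: M(2))
    then have "log_inverse (measure \<mu> (exhaustive_ball X m f n x b))
        \<le> log_inverse (measure \<mu> (exhaustive_ball X m f n x a))"
      by (auto simp: log_inverse_def zero_less_measure_iff measure_le_0_iff)
    then show "\<phi> b n \<le> \<phi> a n"
      unfolding \<phi>_def using \<open>1 \<le> n\<close> by (intro ereal_divide_right_mono) auto
  qed
  have "liminf (\<phi> \<epsilon>) \<le> (SUP e\<in>{0<..}. liminf (\<phi> e))"
    using \<open>0 < \<epsilon>\<close> by (intro SUP_upper) auto
  also have "\<dots> = local_exhaustive_entropy X m f \<mu> x"
    unfolding local_exhaustive_entropy_def
    using Lim_at_right_antimono[of "\<lambda>e. liminf (\<phi> e)", OF anti] by (simp add: \<phi>_def[abs_def])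
  also have "\<dots> < ereal \<beta>" using le \<open>\<alpha> < \<beta>\<close> by (simp add: le_less_trans)
  finally have "\<not> eventually (\<lambda>n. ereal \<beta> \<le> \<phi> \<epsilon> n) sequentially"
    using Liminf_bounded[of "ereal \<beta>" "\<phi> \<epsilon>" sequentially] by auto
  then have "\<forall>N. \<exists>n\<ge>N. \<phi> \<epsilon> n < ereal \<beta>"
    by (simp add: eventually_sequentially not_le)
  \<comment> \<open>Requiring \<open>n \<ge> 1\<close> makes the division by \<open>n\<close>
    meaningful.\<close>
  from this[rule_format, of "max N 1"] obtain n where n: "max N 1 \<le> n" "\<phi> \<epsilon> n < ereal \<beta>"
    by metis
  let ?p = "measure \<mu> (exhaustive_ball X m f n x \<epsilon>)"
  \<comment> \<open>For zero mass the quotient would be infinite by the convention for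
    \<open>log_inverse\<close>.\<close>
  have "?p \<noteq> 0"
    using n by (auto simp: \<phi>_def log_inverse_def)
  then have "?p > 0" by (simp add: less_le)
  moreover from this n have "ln (inverse ?p) / real n < \<beta>"
    by (simp add: \<phi>_def log_inverse_def)
  moreover have "0 < real n" using n by simp
  ultimately have "ln (inverse ?p) < \<beta> * real n" by (simp only: pos_divide_less_eq)
  then have "- \<beta> * real n < ln ?p"
    using \<open>?p > 0\<close> by (simp add: ln_inverse)
  then have "exp (- \<beta> * real n) < ?p"
    using \<open>?p > 0\<close> by (metis exp_less_cancel_iff exp_ln)
  with n show thesis by (intro that) auto
qed

section \<open>Monotonicity of the covering sums\<close>

text \<open>A larger minimal order or a smaller scale leaves fewer admissible families for the
  infimum.\<close>

lemma exhaustive_M_mono: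
  assumes "N \<le> N'" "\<epsilon>' \<le> \<epsilon>"
  shows "exhaustive_M X m f Y l N \<epsilon> \<le> exhaustive_M X m f Y l N' \<epsilon>'"
  unfolding exhaustive_M_def
proof (rule INF_superset_mono)
  show "{(F, n). countable F \<and> F \<subseteq> X \<and> (\<forall>x\<in>F. N' \<le> n x) \<and> Y \<subseteq> (\<Union>x\<in>F. exhaustive_ball X m f (n x) x \<epsilon>')}
     \<subseteq> {(F, n). countable F \<and> F \<subseteq> X \<and> (\<forall>x\<in>F. N \<le> n x) \<and> Y \<subseteq> (\<Union>x\<in>F. exhaustive_ball X m f (n x) x \<epsilon>)}"
    (is "?A \<subseteq> ?B")
  proof
    fix p assume "p \<in> ?A"
    then obtain F n where p: "p = (F, n)" and F: "countable F" "F \<subseteq> X" "\<forall>x\<in>F. N' \<le> n x"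
      "Y \<subseteq> (\<Union>x\<in>F. exhaustive_ball X m f (n x) x \<epsilon>')"
      by (cases p) simp
    have "(\<Union>x\<in>F. exhaustive_ball X m f (n x) x \<epsilon>') \<subseteq> (\<Union>x\<in>F. exhaustive_ball X m f (n x) x \<epsilon>)"
      by (intro UN_mono exhaustive_ball_mono assms(2) order.refl)
    with F assms(1) have "countable F \<and> F \<subseteq> X \<and> (\<forall>x\<in>F. N \<le> n x) \<and>
        Y \<subseteq> (\<Union>x\<in>F. exhaustive_ball X m f (n x) x \<epsilon>)"
      by (meson order.trans)
    then show "p \<in> ?B" by (simp add: p)
  qed
qed simp


lemma exhaustive_m_eq_SUP:
  "exhaustive_m X m f Y l \<epsilon> = (SUP N. exhaustive_M X m f Y l N \<epsilon>)"
  unfolding exhaustive_m_def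
  by (rule limI, rule LIMSEQ_SUP) (auto simp: incseq_def intro: exhaustive_M_mono)

lemma exhaustive_entropy_at_antimono:
  assumes "\<epsilon>' \<le> \<epsilon>"
  shows "exhaustive_entropy_at X m f Y \<epsilon> \<le> exhaustive_entropy_at X m f Y \<epsilon>'"
proof -
  have "exhaustive_m X m f Y l \<epsilon> \<le> exhaustive_m X m f Y l \<epsilon>'" for l
    unfolding exhaustive_m_eq_SUP using assms by (intro SUP_mono') (auto intro: exhaustive_M_mono)
  then have "{l. exhaustive_m X m f Y l \<epsilon>' = 0} \<subseteq> {l. exhaustive_m X m f Y l \<epsilon> = 0}"
    by (metis (mono_tags, lifting) Collect_mono le_zero_eq)
  then show ?thesis
    unfolding exhaustive_entropy_at_def by (intro INF_superset_mono) auto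
qed

section \<open>Covers of a fixed order with few centres\<close>

lemma dyadic_level:
  fixes r \<epsilon> :: real
  assumes "\<epsilon> / 2 ^ K \<le> r" "r \<le> \<epsilon>" "0 < \<epsilon>"
  obtains k where "k \<le> K" "\<epsilon> / 2 ^ Suc k \<le> r" "r \<le> \<epsilon> / 2 ^ k"
proof -
  have "\<exists>k\<le>K. \<epsilon> / 2 ^ Suc k \<le> r \<and> r \<le> \<epsilon> / 2 ^ k"
    using assms(1)
  proof (induction K)
    case 0
    then show ?case using assms by auto
  next
    case (Suc K)
    show ?case
    proof (cases "\<epsilon> / 2 ^ K \<le> r")
      case True
      then show ?thesis using Suc.IH le_SucI by blast
    next
      case False
      then show ?thesis using Suc.prems by (intro exI[of _ K]) auto
    qed
  qed
  with that show thesis by blast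
qed

text \<open>Within a dyadic class the radii differ by a factor of at most 2, so one inner and one
  outer radius serve all its centres. The \<open>K + 1\<close> classes are covered
  separately.\<close>

lemma finite_cover_of_sandwiched:
  fixes A X :: "'a :: euclidean_space set"
  assumes M: "prob_space M" "sets M = sets (restrict_space borel X)"
    and "0 < c" "0 < \<epsilon>" "0 \<le> Q" and "A \<subseteq> X"
    and sandwich: "\<And>x. x \<in> A \<Longrightarrow> \<exists>r. \<epsilon> / 2 ^ K \<le> r \<and> r \<le> \<epsilon> \<and> X \<inter> ball x r \<subseteq> B x \<and> B x \<subseteq> X \<inter> ball x (Q * r)"
    and mass: "\<And>x. x \<in> A \<Longrightarrow> c \<le> measure M (B x)"
  obtains S where "finite S" "S \<subseteq> A" "real (card S) \<le> real (K + 1) * ((1 + 4 * Q) ^ DIM('a) / c)"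
    "A \<subseteq> (\<Union>x\<in>S. B x)"
proof -
  interpret prob_space M by fact
  obtain r where r: "\<And>x. x \<in> A \<Longrightarrow> \<epsilon> / 2 ^ K \<le> r x" "\<And>x. x \<in> A \<Longrightarrow> r x \<le> \<epsilon>"
    "\<And>x. x \<in> A \<Longrightarrow> X \<inter> ball x (r x) \<subseteq> B x" "\<And>x. x \<in> A \<Longrightarrow> B x \<subseteq> X \<inter> ball x (Q * r x)"
    using sandwich by metis
  define A' where "A' k = {x\<in>A. \<epsilon> / 2 ^ Suc k \<le> r x \<and> r x \<le> \<epsilon> / 2 ^ k}" for k
  let ?b = "(1 + 4 * Q) ^ DIM('a) / c"
  have "\<exists>S. finite S \<and> S \<subseteq> A' k \<and> real (card S) \<le> ?b \<and> A' k \<subseteq> (\<Union>x\<in>S. ball x (\<epsilon> / 2 ^ Suc k))" for k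
  proof -
    have pos: "0 < \<epsilon> / 2 ^ Suc k" "0 \<le> Q * (\<epsilon> / 2 ^ k)" using \<open>0 < \<epsilon>\<close> \<open>0 \<le> Q\<close> by auto
    have "c \<le> measure M (X \<inter> ball x (Q * (\<epsilon> / 2 ^ k)))" if "x \<in> A' k" for x
    proof -
      have x: "x \<in> A" "r x \<le> \<epsilon> / 2 ^ k" using that by (auto simp: A'_def)
      have "Q * r x \<le> Q * (\<epsilon> / 2 ^ k)" using x \<open>0 \<le> Q\<close> by (intro mult_left_mono)
      then have "ball x (Q * r x) \<subseteq> ball x (Q * (\<epsilon> / 2 ^ k))" by (rule subset_ball)
      with r(4)[OF x(1)] have sub: "B x \<subseteq> X \<inter> ball x (Q * (\<epsilon> / 2 ^ k))" by blast
      have "X \<inter> ball x (Q * (\<epsilon> / 2 ^ k)) \<in> sets M"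
        unfolding M(2) by (simp add: sets_restrict_space)
      then show ?thesis
        using mass[OF x(1)] finite_measure_mono[OF sub] by simp
    qed
    from finite_cover_of_mass[OF M pos \<open>0 < c\<close> this]
    obtain S where "finite S" "S \<subseteq> A' k" "A' k \<subseteq> (\<Union>x\<in>S. ball x (\<epsilon> / 2 ^ Suc k))"
      "real (card S) \<le> (1 + 2 * (Q * (\<epsilon> / 2 ^ k)) / (\<epsilon> / 2 ^ Suc k)) ^ DIM('a) / c"
      by metis
    \<comment> \<open>One factor 2 comes from the packing bound, the other from the width of a
      dyadic class.\<close>
    moreover have "2 * (Q * (\<epsilon> / 2 ^ k)) / (\<epsilon> / 2 ^ Suc k) = 4 * Q"
      using \<open>0 < \<epsilon>\<close> by (simp add: field_simps)
    ultimately show ?thesis by auto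
  qed
  then obtain S where S: "\<And>k. finite (S k)" "\<And>k. S k \<subseteq> A' k" "\<And>k. real (card (S k)) \<le> ?b"
    "\<And>k. A' k \<subseteq> (\<Union>x\<in>S k. ball x (\<epsilon> / 2 ^ Suc k))"
    by metis
  show thesis
  proof (rule that[of "\<Union>k\<le>K. S k"])
    show "finite (\<Union>k\<le>K. S k)" using S(1) by blast
    show "(\<Union>k\<le>K. S k) \<subseteq> A" using S(2) by (auto simp: A'_def)
    have "real (card (\<Union>k\<le>K. S k)) \<le> (\<Sum>k\<le>K. real (card (S k)))"
      using card_UN_le[of "{..K}" S] by (simp flip: of_nat_sum)
    also have "\<dots> \<le> (\<Sum>k\<le>K. ?b)" using S(3) by (rule sum_mono)
    finally show "real (card (\<Union>k\<le>K. S k)) \<le> real (K + 1) * ?b" by simp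
    show "A \<subseteq> (\<Union>x\<in>\<Union>k\<le>K. S k. B x)"
    proof
      fix y assume y: "y \<in> A"
      obtain k where k: "k \<le> K" "\<epsilon> / 2 ^ Suc k \<le> r y" "r y \<le> \<epsilon> / 2 ^ k"
        using dyadic_level[OF r(1,2)[OF y] \<open>0 < \<epsilon>\<close>] .
      then have "y \<in> A' k" using y by (simp add: A'_def)
      then obtain x where x: "x \<in> S k" "dist x y < \<epsilon> / 2 ^ Suc k"
        using S(4)[of k] by auto
      \<comment> \<open>The centre lies in the same class as \<open>y\<close>, so its own inner
        radius is at least the common covering radius.\<close>
      have "x \<in> A' k" using S(2) x by blast
      then have "x \<in> A" "\<epsilon> / 2 ^ Suc k \<le> r x" by (simp_all add: A'_def)
      with x have "y \<in> X \<inter> ball x (r x)" using y \<open>A \<subseteq> X\<close> by auto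
      then have "y \<in> B x" using r(3)[OF \<open>x \<in> A\<close>] by blast
      with x k show "y \<in> (\<Union>x\<in>\<Union>k\<le>K. S k. B x)" by blast
    qed
  qed
qed

section \<open>Summing the covers over all large orders\<close>

text \<open>The centres of all orders from \<open>N\<close> on form one admissible family, whose
  weight is at most a tail of the series \<open>u\<close>.\<close>

lemma exhaustive_M_le_tail:
  assumes S: "\<And>n. finite (S n)" "\<And>n. S n \<subseteq> X"
    and u: "\<And>n. real (card (S n)) * exp (- l * real n) \<le> u n" "summable u"
    and cover: "\<And>y. y \<in> Y \<Longrightarrow> \<exists>n\<ge>N. \<exists>x\<in>S n. y \<in> exhaustive_ball X m f n x \<epsilon>"
  shows "exhaustive_M X m f Y l N \<epsilon> \<le> ennreal (\<Sum>i. u (i + N))"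
proof -
  define F where "F = (\<Union>n\<in>{N..}. S n)"
  \<comment> \<open>A centre may occur in several \<open>S n\<close> but is allowed only one order; the least one gives the largest ball.\<close>
  define t where "t x = (LEAST n. N \<le> n \<and> x \<in> S n)" for x
  have t: "N \<le> t x \<and> x \<in> S (t x)" if "x \<in> F" for x
    using that LeastI_ex[of "\<lambda>n. N \<le> n \<and> x \<in> S n"] unfolding t_def F_def by auto
  have t_le: "t x \<le> n" if "N \<le> n" "x \<in> S n" for x n
    using that unfolding t_def by (intro Least_le) auto
  have u0: "0 \<le> u n" for n
    using order.trans[OF _ u(1)[of n], of 0] by simp
  have "countable F" unfolding F_def using S(1) by (intro countable_UN) (auto intro: countable_finite)
  moreover have "F \<subseteq> X" using S(2) by (auto simp: F_def)
  moreover have "Y \<subseteq> (\<Union>x\<in>F. exhaustive_ball X m f (t x) x \<epsilon>)"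
  proof
    fix y assume "y \<in> Y"
    then obtain n x where n: "N \<le> n" "x \<in> S n" "y \<in> exhaustive_ball X m f n x \<epsilon>"
      using cover by blast
    then have "x \<in> F" by (auto simp: F_def)
    moreover have "y \<in> exhaustive_ball X m f (t x) x \<epsilon>"
      using exhaustive_ball_antimono[OF t_le[OF n(1,2)]] n(3) by blast
    ultimately show "y \<in> (\<Union>x\<in>F. exhaustive_ball X m f (t x) x \<epsilon>)" by blast
  qed
  ultimately have "exhaustive_M X m f Y l N \<epsilon> \<le> (\<Sum>\<^sub>\<infinity>x\<in>F. ennreal (exp (- l * real (t x))))"
    unfolding exhaustive_M_def using t by (intro INF_lower2[of "(F, t)"]) auto
  also have "\<dots> \<le> ennreal (\<Sum>i. u (i + N))"
  proof (rule infsum_le_finite_sums)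
    show "(\<lambda>x. ennreal (exp (- l * real (t x)))) summable_on F"
      by (simp add: nonneg_summable_on_complete)
    fix T assume T: "finite T" "T \<subseteq> F"
    \<comment> \<open>The centres are grouped by assigned order: those of order \<open>n\<close> lie
      in \<open>S n\<close>, so each group weighs at most \<open>u n\<close>.\<close>
    have "(\<Sum>x\<in>T. exp (- l * real (t x))) = (\<Sum>n\<in>t ` T. \<Sum>x\<in>{x\<in>T. t x = n}. exp (- l * real (t x)))"
      using T(1) by (rule sum.image_gen)
    also have "\<dots> \<le> (\<Sum>n\<in>t ` T. u n)"
    proof (rule sum_mono)
      fix n
      have "(\<Sum>x\<in>{x\<in>T. t x = n}. exp (- l * real (t x))) = real (card {x\<in>T. t x = n}) * exp (- l * real n)"
        by simp
      also have "\<dots> \<le> real (card (S n)) * exp (- l * real n)"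
        using T t S(1) by (intro mult_right_mono of_nat_mono card_mono) auto
      also have "\<dots> \<le> u n" by (rule u)
      finally show "(\<Sum>x\<in>{x\<in>T. t x = n}. exp (- l * real (t x))) \<le> u n" .
    qed
    \<comment> \<open>All assigned orders are at least \<open>N\<close>, so truncated subtraction is
      injective on them.\<close>
    also have "\<dots> = (\<Sum>i\<in>(\<lambda>n. n - N) ` t ` T. u (i + N))"
      using T(2) t
      by (intro sum.reindex_bij_witness[of _ "\<lambda>i. i + N" "\<lambda>n. n - N"]) (auto simp: subset_iff)
    also have "\<dots> \<le> (\<Sum>i. u (i + N))"
      using T(1) u(2) u0 by (intro sum_le_suminf) (auto simp: summable_iff_shift)
    finally show "(\<Sum>x\<in>T. ennreal (exp (- l * real (t x)))) \<le> ennreal (\<Sum>i. u (i + N))"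
      by (simp add: sum_ennreal ennreal_leI)
  qed
  finally show ?thesis .
qed

text \<open>Every point is covered at arbitrarily large orders, so the tail bound holds for each
  \<open>N\<close>, and tails of a summable series vanish.\<close>

lemma exhaustive_m_eq_0:
  assumes S: "\<And>n. finite (S n)" "\<And>n. S n \<subseteq> X"
    and u: "\<And>n. real (card (S n)) * exp (- l * real n) \<le> u n" "summable u"
    and cover: "\<And>y N. y \<in> Y \<Longrightarrow> \<exists>n\<ge>N. \<exists>x\<in>S n. y \<in> exhaustive_ball X m f n x \<epsilon>"
  shows "exhaustive_m X m f Y l \<epsilon> = 0"
proof -
  have tail: "exhaustive_M X m f Y l N \<epsilon> \<le> ennreal (\<Sum>i. u (i + N))" for N
    by (rule exhaustive_M_le_tail[of S X l u Y N m f \<epsilon>]) (fact S u cover)+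
  have "(\<lambda>N. ennreal (\<Sum>i. u (i + N))) \<longlonglongrightarrow> 0"
    using tendsto_ennrealI[OF suminf_exist_split2[OF u(2)]] by simp
  then have "(\<lambda>N. exhaustive_M X m f Y l N \<epsilon>) \<longlonglongrightarrow> 0"
    by (rule tendsto_sandwich[OF always_eventually always_eventually tendsto_const, rotated -1])
      (simp_all add: tail)
  then show ?thesis
    unfolding exhaustive_m_def by (rule limI)
qed


text \<open>Assumption \<open>q\<close> says that the gap between \<open>l\<close> and \<beta>
  outweighs the overlap growth caused by distortion. The order-\<open>n\<close> cover then weighs at
  most a constant times \<open>(n + 1) * q ^ n\<close>.\<close>

lemma exhaustive_entropy_at_le:
  fixes X Y :: "(real ^ 'd) set" and f :: "nat \<Rightarrow> real ^ 'd \<Rightarrow> real ^ 'd"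
  assumes map: "\<And>j. j \<in> {1..m} \<Longrightarrow> f j ` X \<subseteq> X" and cont: "\<And>j. j \<in> {1..m} \<Longrightarrow> continuous_on X (f j)"
    and b: "\<And>j x. j \<in> {1..m} \<Longrightarrow> x \<in> X \<Longrightarrow> 1 \<le> b j x" "\<And>j x. j \<in> {1..m} \<Longrightarrow> x \<in> X \<Longrightarrow> b j x \<le> L" "1 \<le> L"
    and est: "\<And>j x z. j \<in> {1..m} \<Longrightarrow> x \<in> X \<Longrightarrow> z \<in> X \<Longrightarrow> dist x z < \<epsilon> \<Longrightarrow>
       (1 - \<eta>) * b j x * dist x z \<le> dist (f j x) (f j z) \<and>
       dist (f j x) (f j z) \<le> (1 + \<eta>) * b j x * dist x z"
    and \<eta>: "0 < \<eta>" "\<eta> < 1" and \<epsilon>: "0 < \<epsilon>"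
    and M: "prob_space \<mu>" "sets \<mu> = sets (restrict_space borel X)" and Y: "Y \<subseteq> X"
    and ent: "\<And>x. x \<in> Y \<Longrightarrow> local_exhaustive_entropy X m f \<mu> x \<le> ereal \<alpha>" and "\<alpha> < \<beta>"
    and q: "((1 + \<eta>) / (1 - \<eta>)) ^ CARD('d) * exp (\<beta> - l) < 1"
  shows "exhaustive_entropy_at X m f Y \<epsilon> \<le> ereal l"
proof -
  define \<rho> where "\<rho> = (1 + \<eta>) / (1 - \<eta>)"
  define q where "q = \<rho> ^ CARD('d) * exp (\<beta> - l)"
  have "1 \<le> \<rho>" using \<eta> by (simp add: \<rho>_def field_simps)
  have "0 \<le> q" "q < 1" using q \<open>1 \<le> \<rho>\<close> by (auto simp: q_def \<rho>_def)
  \<comment> \<open>This turns the lower bound on radii into \<epsilon> divided by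
    \<open>2 ^ (K * n)\<close>, giving \<open>K * n + 1\<close> dyadic classes.\<close>
  obtain K :: nat where K: "2 * L \<le> 2 ^ K"
    using real_arch_pow[of 2 "2 * L"] less_imp_le by auto
  define A where "A n = {x\<in>Y. exp (- \<beta> * real n) < measure \<mu> (exhaustive_ball X m f n x \<epsilon>)}" for n
  have "\<exists>S. finite S \<and> S \<subseteq> A n \<and>
      real (card S) \<le> real (K * n + 1) * ((1 + 4 * \<rho> ^ n) ^ CARD('d) / exp (- \<beta> * real n)) \<and>
      A n \<subseteq> (\<Union>x\<in>S. exhaustive_ball X m f n x \<epsilon>)" for n
  proof -
    have AX: "A n \<subseteq> X" using Y by (auto simp: A_def)
    have sw: "\<exists>r. \<epsilon> / 2 ^ (K * n) \<le> r \<and> r \<le> \<epsilon> \<and> X \<inter> ball x r \<subseteq> exhaustive_ball X m f n x \<epsilon> \<and>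
         exhaustive_ball X m f n x \<epsilon> \<subseteq> X \<inter> ball x (\<rho> ^ n * r)" if x: "x \<in> A n" for x
    proof -
      \<comment> \<open>Positive mass excludes the degenerate case \<open>m = 0\<close>,
        \<open>n > 0\<close>, in which there are no words and the ball is empty.\<close>
      have "0 < measure \<mu> (exhaustive_ball X m f n x \<epsilon>)"
        using x exp_gt_zero[of "- \<beta> * real n"] by (simp add: A_def del: exp_gt_zero)
      then have ne: "words m n \<noteq> {}" by (auto simp: exhaustive_ball_def)
      have xX: "x \<in> X" using x AX by blast
      obtain r where r: "\<epsilon> / (2 * L) ^ n \<le> r" "r \<le> \<epsilon>"
        "X \<inter> ball x r \<subseteq> exhaustive_ball X m f n x \<epsilon>"
        "exhaustive_ball X m f n x \<epsilon> \<subseteq> X \<inter> ball x (((1 + \<eta>) / (1 - \<eta>)) ^ n * r)"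
        by (rule exhaustive_ball_sandwich[of m f X b L \<epsilon> \<eta> n x, OF map b(1,2) est \<eta> \<epsilon> ne xX])
          (assumption | rule that)+
      have "(2 * L) ^ n \<le> (2 ^ K) ^ n" using K b(3) by (intro power_mono) auto
      then have "\<epsilon> / 2 ^ (K * n) \<le> \<epsilon> / (2 * L) ^ n"
        using \<epsilon> b(3) by (intro divide_left_mono) (auto simp: power_mult)
      with r show ?thesis unfolding \<rho>_def by (intro exI[of _ r]) auto
    qed
    have mass: "exp (- \<beta> * real n) \<le> measure \<mu> (exhaustive_ball X m f n x \<epsilon>)" if "x \<in> A n" for x
      using that by (simp add: A_def)
    have "0 \<le> \<rho> ^ n" using \<open>1 \<le> \<rho>\<close> by simp
    from finite_cover_of_sandwiched[where B = "\<lambda>x. exhaustive_ball X m f n x \<epsilon>",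
        OF M exp_gt_zero \<epsilon> this AX sw mass]
    show ?thesis by (simp only: DIM_cart DIM_real mult_1_right) metis
  qed
  then obtain S where S: "\<And>n. finite (S n)" "\<And>n. S n \<subseteq> A n"
    "\<And>n. real (card (S n)) \<le> real (K * n + 1) * ((1 + 4 * \<rho> ^ n) ^ CARD('d) / exp (- \<beta> * real n))"
    "\<And>n. A n \<subseteq> (\<Union>x\<in>S n. exhaustive_ball X m f n x \<epsilon>)"
    by metis
  \<comment> \<open>The constants come from \<open>K * n + 1 \<le> (K + 1) * Suc n\<close> and
    \<open>1 + 4 * \<rho> ^ n \<le> 5 * \<rho> ^ n\<close>. Summability is that of the
    differentiated geometric series.\<close>
  define u where "u n = (real (K + 1) * 5 ^ CARD('d)) * (of_nat (Suc n) * q ^ n)" for n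
  have "exhaustive_m X m f Y l \<epsilon> = 0"
  proof (rule exhaustive_m_eq_0[OF S(1)])
    show "S n \<subseteq> X" for n using S(2)[of n] Y by (auto simp: A_def)
    show "summable u"
      unfolding u_def using \<open>0 \<le> q\<close> \<open>q < 1\<close> geometric_deriv_sums[of q]
      by (intro summable_mult) (auto simp: sums_iff)
    show "real (card (S n)) * exp (- l * real n) \<le> u n" for n
    proof -
      have "1 \<le> \<rho> ^ n" using \<open>1 \<le> \<rho>\<close> by simp
      then have "(1 + 4 * \<rho> ^ n) ^ CARD('d) \<le> (5 * \<rho> ^ n) ^ CARD('d)"
        by (intro power_mono) auto
      also have "\<dots> = 5 ^ CARD('d) * (\<rho> ^ CARD('d)) ^ n"
        by (simp add: power_mult_distrib mult.commute flip: power_mult)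
      finally have 1: "(1 + 4 * \<rho> ^ n) ^ CARD('d) \<le> 5 ^ CARD('d) * (\<rho> ^ CARD('d)) ^ n" .
      have "K * n + 1 \<le> (K + 1) * Suc n" by simp
      then have 2: "real (K * n + 1) \<le> real (K + 1) * of_nat (Suc n)"
        unfolding of_nat_mult[symmetric] by (rule of_nat_mono)
      have "real (card (S n)) * exp (- l * real n)
          \<le> real (K * n + 1) * ((1 + 4 * \<rho> ^ n) ^ CARD('d) / exp (- \<beta> * real n)) * exp (- l * real n)"
        by (intro mult_right_mono S(3)) auto
      also have "\<dots> \<le> (real (K + 1) * of_nat (Suc n)) * (5 ^ CARD('d) * (\<rho> ^ CARD('d)) ^ n / exp (- \<beta> * real n)) * exp (- l * real n)"
        using \<open>1 \<le> \<rho>\<close> by (intro mult_right_mono mult_mono 2 divide_right_mono 1) auto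
      also have "\<dots> = u n"
      proof -
        have "exp (- l * real n) / exp (- \<beta> * real n) = exp (\<beta> - l) ^ n"
          by (simp add: algebra_simps flip: exp_diff exp_of_nat_mult)
        then have "exp (- l * real n) = exp (\<beta> - l) ^ n * exp (- \<beta> * real n)"
          by (simp add: field_simps)
        then show ?thesis by (simp add: u_def q_def power_mult_distrib)
      qed
      finally show ?thesis .
    qed
    fix y N assume y: "y \<in> Y"
    obtain n where n: "N \<le> n" "exp (- \<beta> * real n) < measure \<mu> (exhaustive_ball X m f n y \<epsilon>)"
      by (rule local_exhaustive_entropy_le_imp_frequently[of m f X, OF map cont M ent[OF y] \<open>\<alpha> < \<beta>\<close> \<epsilon>])
        (assumption | rule that)+
    then have "y \<in> A n" using y by (simp add: A_def)
    with n S(4)[of n] show "\<exists>n\<ge>N. \<exists>x\<in>S n. y \<in> exhaustive_ball X m f n x \<epsilon>" by blast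
  qed
  then show ?thesis
    unfolding exhaustive_entropy_at_def by (intro INF_lower) simp
qed

lemma conformal_expanding_on_imp_continuous_on:
  assumes "conformal_expanding_on X m f" "j \<in> {1..m}"
  shows "continuous_on X (f j)"
  using assms C1_on_imp_continuous_on unfolding conformal_expanding_on_def by metis

theorem theorem6p8:
  fixes X Y :: "(real ^ 'd) set"
    and m :: nat
    and f :: "nat \<Rightarrow> real ^ 'd \<Rightarrow> real ^ 'd"
    and \<mu> :: "(real ^ 'd) measure"
    and \<alpha> :: real
  assumes "compact X"
    and "\<And>j. j \<in> {1..m} \<Longrightarrow> f j ` X \<subseteq> X"
    and "conformal_expanding_on X m f"
    and "prob_space \<mu>"
    and "sets \<mu> = sets (restrict_space borel X)"
    and "Y \<subseteq> X"
    and "\<alpha> > 0"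
    and "\<And>x. x \<in> Y \<Longrightarrow> local_exhaustive_entropy X m f \<mu> x \<le> ereal \<alpha>"
  shows "exhaustive_entropy X m f Y \<le> ereal \<alpha>"
proof -
  obtain b L where b: "\<And>j x. j \<in> {1..m} \<Longrightarrow> x \<in> X \<Longrightarrow> 1 \<le> b j x"
    "\<And>j x. j \<in> {1..m} \<Longrightarrow> x \<in> X \<Longrightarrow> b j x \<le> L" "1 \<le> L"
    and est: "\<And>\<eta>. 0 < \<eta> \<Longrightarrow> \<exists>\<delta>>0. \<forall>j\<in>{1..m}. \<forall>x\<in>X. \<forall>z\<in>X. dist x z < \<delta> \<longrightarrow>
       (1 - \<eta>) * b j x * dist x z \<le> dist (f j x) (f j z) \<and>
       dist (f j x) (f j z) \<le> (1 + \<eta>) * b j x * dist x z"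
    by (rule conformal_expanding_estimate[OF assms(1,3)]) (rule that)
  have anti: "exhaustive_entropy_at X m f Y \<epsilon> \<le> exhaustive_entropy_at X m f Y \<epsilon>'" if "\<epsilon>' \<le> \<epsilon>" for \<epsilon> \<epsilon>'
    using that by (rule exhaustive_entropy_at_antimono)
  have le: "exhaustive_entropy_at X m f Y \<epsilon> \<le> ereal l" if "\<alpha> < l" "0 < \<epsilon>" for l \<epsilon>
  proof -
    \<comment> \<open>The midpoint leaves room on both sides: above \<alpha> for the mass estimate,
      below \<open>l\<close> for a convergent series.\<close>
    define \<beta> where "\<beta> = (\<alpha> + l) / 2"
    have \<beta>: "\<alpha> < \<beta>" "\<beta> < l" using that by (auto simp: \<beta>_def)
    \<comment> \<open>Without distortion the ratio is \<open>exp (\<beta> - l) < 1\<close>; by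
      continuity it stays below 1 for small positive \<eta>.\<close>
    have "((\<lambda>\<eta>. ((1 + \<eta>) / (1 - \<eta>)) ^ CARD('d) * exp (\<beta> - l)) \<longlongrightarrow>
        ((1 + 0) / (1 - 0)) ^ CARD('d) * exp (\<beta> - l)) (at_right (0::real))"
      by (intro tendsto_intros) auto
    then have "eventually (\<lambda>\<eta>. ((1 + \<eta>) / (1 - \<eta>)) ^ CARD('d) * exp (\<beta> - l) < 1) (at_right (0::real))"
      using \<beta> by (intro order_tendstoD) auto
    moreover have "eventually (\<lambda>\<eta>. \<eta> \<in> {0<..<1}) (at_right (0::real))"
      by (rule eventually_at_right_real) simp
    ultimately have "eventually (\<lambda>\<eta>. ((1 + \<eta>) / (1 - \<eta>)) ^ CARD('d) * exp (\<beta> - l) < 1 \<and> \<eta> \<in> {0<..<1}) (at_right (0::real))"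
      by (rule eventually_conj)
    then obtain \<eta> where \<eta>: "((1 + \<eta>) / (1 - \<eta>)) ^ CARD('d) * exp (\<beta> - l) < 1" "0 < \<eta>" "\<eta> < 1"
      using eventually_happens[of _ "at_right (0::real)"] by auto
    from est[OF \<eta>(2)] obtain \<delta> where \<delta>: "0 < \<delta> \<and> (\<forall>j\<in>{1..m}. \<forall>x\<in>X. \<forall>z\<in>X. dist x z < \<delta> \<longrightarrow>
       (1 - \<eta>) * b j x * dist x z \<le> dist (f j x) (f j z) \<and>
       dist (f j x) (f j z) \<le> (1 + \<eta>) * b j x * dist x z)" ..
    \<comment> \<open>The distortion estimate holds only below \<delta>; passing to a smaller scale
      can only raise the entropy to be bounded.\<close>
    have "exhaustive_entropy_at X m f Y \<epsilon> \<le> exhaustive_entropy_at X m f Y (min \<delta> \<epsilon>)"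
      by (rule anti) simp
    also have "\<dots> \<le> ereal l"
    proof (rule exhaustive_entropy_at_le[of m f X b L "min \<delta> \<epsilon>" \<eta> \<mu> Y \<alpha> \<beta> l])
      show "(1 - \<eta>) * b j x * dist x z \<le> dist (f j x) (f j z) \<and>
          dist (f j x) (f j z) \<le> (1 + \<eta>) * b j x * dist x z"
        if "j \<in> {1..m}" "x \<in> X" "z \<in> X" "dist x z < min \<delta> \<epsilon>" for j x z
        using \<delta> that by simp
      show "continuous_on X (f j)" if "j \<in> {1..m}" for j
        using assms(3) that by (rule conformal_expanding_on_imp_continuous_on)
      show "0 < min \<delta> \<epsilon>" using \<delta> \<open>0 < \<epsilon>\<close> by simp
    qed (fact assms b \<eta> \<beta>)+
    finally show ?thesis .
  qed
  have "exhaustive_entropy X m f Y = (SUP \<epsilon>\<in>{0<..}. exhaustive_entropy_at X m f Y \<epsilon>)"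
    unfolding exhaustive_entropy_def by (intro Lim_at_right_antimono anti)
  also have "\<dots> \<le> ereal \<alpha>"
  proof (rule SUP_least, rule ereal_le_epsilon2)
    fix \<epsilon> e :: real assume "\<epsilon> \<in> {0<..}" "0 < e"
    then show "exhaustive_entropy_at X m f Y \<epsilon> \<le> ereal \<alpha> + ereal e"
      using le[of "\<alpha> + e" \<epsilon>] by simp
  qed
  finally show ?thesis .
qed

end
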